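(* The monad on $\mathsf{Pos}$ induced by the ordered algebraic theory $\mathbb{S}$ of ordered subconvex algebras assigns to a poset $X$ the set of all finitely supported subdistributions on (the underlying set of) $X$, equipped with the order $\preccurlyeq$.
   Context: $\mathbb{S}$ is the graded theory all of whose operations have depth $0$ and discrete arity: for each $n\in\omega$ and $p_1,\dots,p_n\in[0,1]$ with $\sum_ip_i\le1$, an $n$-ary operation $\sum_{i=1}^np_i\cdot(-)$ (formal subconvex combination). Its axioms (in discrete contexts) are: $\sum_k\delta_{ik}\cdot x_k=x_i$ ($\delta_{ik}$ Kronecker delta); $\sum_{i=1}^np_i\cdot\sum_{k=1}^mq_{ik}\cdot x_k=\sum_{k=1}^m(\sum_{i=1}^np_iq_{ik})\cdot x_k$; and $\sum_{i=1}^np_i\cdot x_i\le\sum_{i=1}^nq_i\cdot x_i$ whenever $p_i\le q_i$ for all $i$ (equations stand for two inequations). A model is a poset $A$ with monotone interpretations of all operations satisfying the axioms; the monad induced by $\mathbb{S}$ sends $X$ to the free model on $X$ (formed from terms modulo derivable equality, ordered by derivable inequality, in the logic of inequations in context: rules of reflexivity on variables, monotonicity of operations, transitivity, and instantiation of axioms). A finitely supported subdistribution on a set $X$ is a map $\mu\colon X\to[0,1]$ with finite support and $\sum_x\mu(x)\le1$; it is represented by a formal sum $\sum_{i=1}^np_i\cdot x_i$ ($p_i\in(0,1]$, $\sum p_i\le1$), which represents $x\mapsto\sum_{i:x_i=x}p_i$. A subdivision of $\sum_{i=1}^np_i\cdot x_i$ is a formal combination $\sum_{i=1}^n(\sum_{j=1}^{m_i}\bar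 p_{ij})\cdot x_i$ (i.e. with the summand $p_i\cdot x_i$ replaced by summands $\bar p_{i1}\cdot x_i,\dots,\bar p_{im_i}\cdot x_i$) where $\sum_{j=1}^{m_i}\bar p_{ij}=p_i$ for all $i$. $\sum_{i=1}^np_i\cdot x_i$ is obviously below $\sum_{i=1}^mq_i\cdot y_i$, written $\sqsubseteq$, if there is an injective $f\colon\{1,\dots,n\}\to\{1,\dots,m\}$ with $p_i\le q_{f(i)}$ and $x_i\le y_{f(i)}$ for all $i$. Then $\sum_ip_i\cdot x_i\preccurlyeq\sum_jq_j\cdot y_j$ iff there are subdivisions $d_1,d_2$ of these, respectively, with $d_1\sqsubseteq d_2$. *)

theory Defs
  imports Complex_Main
begin

section \<open>Ordered algebraic theories with discrete arities and discrete contexts\<close>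

datatype ('f, 'v) trm = Var 'v | Op 'f "('f, 'v) trm list"

primrec subst :: "('v \<Rightarrow> ('f, 'w) trm) \<Rightarrow> ('f, 'v) trm \<Rightarrow> ('f, 'w) trm" where
  "subst \<sigma> (Var x) = \<sigma> x"
| "subst \<sigma> (Op f ts) = Op f (map (subst \<sigma>) ts)"

text \<open>A pair \<open>(s, t)\<close> among the axioms stands for the inequation \<open>s \<le> t\<close>, in the discrete
  context of the variables (natural numbers) that occur in \<open>s\<close> or \<open>t\<close>.\<close>

record 'f otheory =
  operations :: "'f set"
  arity :: "'f \<Rightarrow> nat"
  inequations :: "(('f, nat) trm \<times> ('f, nat) trm) set"

inductive_set terms :: "'f otheory \<Rightarrow> 'v set \<Rightarrow> ('f, 'v) trm set"
  for T :: "'f otheory" and X :: "'v set" where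
  Var: "x \<in> X \<Longrightarrow> Var x \<in> terms T X"
| Op: "\<lbrakk>f \<in> operations T; length ts = arity T f; \<forall>t\<in>set ts. t \<in> terms T X\<rbrakk> \<Longrightarrow> Op f ts \<in> terms T X"

text \<open>Derivable inequality between terms in the context given by the poset \<open>(X, r)\<close>,
  where \<open>(x, y) \<in> r\<close> means \<open>x \<le> y\<close>.\<close>

inductive derivable ::
    "'f otheory \<Rightarrow> 'v set \<Rightarrow> 'v rel \<Rightarrow> ('f, 'v) trm \<Rightarrow> ('f, 'v) trm \<Rightarrow> bool"
  for T :: "'f otheory" and X :: "'v set" and r :: "'v rel" where
  var: "\<lbrakk>x \<in> X; y \<in> X; (x, y) \<in> r\<rbrakk> \<Longrightarrow> derivable T X r (Var x) (Var y)"
| mon: "\<lbrakk>f \<in> operations T; length ss = arity T f; list_all2 (derivable T X r) ss ts\<rbrakk>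
    \<Longrightarrow> derivable T X r (Op f ss) (Op f ts)"
| trans: "\<lbrakk>derivable T X r s t; derivable T X r t u\<rbrakk> \<Longrightarrow> derivable T X r s u"
| ax: "\<lbrakk>(s, t) \<in> inequations T; \<forall>v \<in> set2_trm s \<union> set2_trm t. \<sigma> v \<in> terms T X\<rbrakk>
    \<Longrightarrow> derivable T X r (subst \<sigma> s) (subst \<sigma> t)"

definition derivable_eq :: "'f otheory \<Rightarrow> 'v set \<Rightarrow> 'v rel \<Rightarrow> ('f, 'v) trm rel" where
  "derivable_eq T X r =
    {(s, t). s \<in> terms T X \<and> t \<in> terms T X \<and> derivable T X r s t \<and> derivable T X r t s}"

text \<open>The free model on the poset \<open>(X, r)\<close>, that is, the value at \<open>(X, r)\<close> of the induced monad:
  its underlying set, its order, its unit, and its interpretation of the operations.\<close>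

definition free_model :: "'f otheory \<Rightarrow> 'v set \<Rightarrow> 'v rel \<Rightarrow> ('f, 'v) trm set set" where
  "free_model T X r = terms T X // derivable_eq T X r"

definition term_class :: "'f otheory \<Rightarrow> 'v set \<Rightarrow> 'v rel \<Rightarrow> ('f, 'v) trm \<Rightarrow> ('f, 'v) trm set" where
  "term_class T X r t = derivable_eq T X r `` {t}"

definition free_order :: "'f otheory \<Rightarrow> 'v set \<Rightarrow> 'v rel \<Rightarrow> ('f, 'v) trm set rel" where
  "free_order T X r =
    {(term_class T X r s, term_class T X r t) | s t.
      s \<in> terms T X \<and> t \<in> terms T X \<and> derivable T X r s t}"


section \<open>The theory of ordered subconvex algebras\<close>

text \<open>The operation \<open>\<Sum>i=1..n. p\<^sub>i \<cdot> (-)\<close> is represented by the list \<open>[p\<^sub>1, \<dots>, p\<^sub>n]\<close>;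
  indices start at \<open>0\<close> below.\<close>

definition subconvex :: "real list \<Rightarrow> bool" where
  "subconvex ps \<longleftrightarrow> set ps \<subseteq> {0..1} \<and> sum_list ps \<le> 1"

definition comb :: "real list \<Rightarrow> (real list, nat) trm" where
  "comb ps = Op ps (map Var [0..<length ps])"

definition projection_eqs :: "((real list, nat) trm \<times> (real list, nat) trm) set" where
  "projection_eqs = {(comb (map (\<lambda>k. if i = k then 1 else 0) [0..<n]), Var i) | i n. i < n}"

definition composition_eqs :: "((real list, nat) trm \<times> (real list, nat) trm) set" where
  "composition_eqs =
    {(Op ps (map comb qss), comb (map (\<lambda>k. \<Sum>i<length ps. ps ! i * qss ! i ! k) [0..<m])) | ps qss m.
      subconvex ps \<and> length qss = length ps \<and> (\<forall>qs\<in>set qss. subconvex qs \<and> length qs = m)}"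

definition weight_ineqs :: "((real list, nat) trm \<times> (real list, nat) trm) set" where
  "weight_ineqs = {(comb ps, comb qs) | ps qs. subconvex ps \<and> subconvex qs \<and> list_all2 (\<le>) ps qs}"

definition subconvex_theory :: "real list otheory" where
  "subconvex_theory =
    \<lparr> operations = {ps. subconvex ps},
      arity = length,
      inequations = projection_eqs \<union> projection_eqs\<inverse> \<union> composition_eqs \<union> composition_eqs\<inverse> \<union> weight_ineqs \<rparr>"


section \<open>Finitely supported subdistributions\<close>

text \<open>Maps on the set \<open>X\<close> are represented as functions on the whole type that vanish outside \<open>X\<close>.\<close>

definition subdists :: "'a set \<Rightarrow> ('a \<Rightarrow> real) set" where
  "subdists X = {\<mu>. (\<forall>x. 0 \<le> \<mu> x \<and> \<mu> x \<le> 1) \<and> {x. \<mu> x \<noteq> 0} \<subseteq> X \<and>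
    finite {x. \<mu> x \<noteq> 0} \<and> (\<Sum>x | \<mu> x \<noteq> 0. \<mu> x) \<le> 1}"

type_synonym 'a formal_sum = "(real \<times> 'a) list"

definition formal_sums :: "'a set \<Rightarrow> 'a formal_sum set" where
  "formal_sums X = {c. set c \<subseteq> {0<..1} \<times> X \<and> sum_list (map fst c) \<le> 1}"

definition subdist_of :: "'a formal_sum \<Rightarrow> 'a \<Rightarrow> real" where
  "subdist_of c x = (\<Sum>i | i < length c \<and> snd (c ! i) = x. fst (c ! i))"

text \<open>The list \<open>pss ! i\<close> consists of the weights that replace the \<open>i\<close>-th weight of \<open>c\<close>.\<close>

definition is_subdivision :: "'a formal_sum \<Rightarrow> 'a formal_sum \<Rightarrow> bool" where
  "is_subdivision d c \<longleftrightarrow>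
    (\<exists>pss. length pss = length c \<and>
      (\<forall>i<length c. set (pss ! i) \<subseteq> {0<..1} \<and> sum_list (pss ! i) = fst (c ! i)) \<and>
      d = concat (map2 (\<lambda>ps (p, x). map (\<lambda>q. (q, x)) ps) pss c))"

definition obviously_below :: "'a rel \<Rightarrow> 'a formal_sum \<Rightarrow> 'a formal_sum \<Rightarrow> bool" where
  "obviously_below r c d \<longleftrightarrow>
    (\<exists>f. inj_on f {..<length c} \<and> f ` {..<length c} \<subseteq> {..<length d} \<and>
      (\<forall>i<length c. fst (c ! i) \<le> fst (d ! f i) \<and> (snd (c ! i), snd (d ! f i)) \<in> r))"

definition formal_le :: "'a rel \<Rightarrow> 'a formal_sum \<Rightarrow> 'a formal_sum \<Rightarrow> bool" where
  "formal_le r c d \<longleftrightarrow>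
    (\<exists>c' d'. is_subdivision c' c \<and> is_subdivision d' d \<and> obviously_below r c' d')"

definition subdist_order :: "'a set \<Rightarrow> 'a rel \<Rightarrow> ('a \<Rightarrow> real) rel" where
  "subdist_order X r =
    {(subdist_of c, subdist_of d) | c d. c \<in> formal_sums X \<and> d \<in> formal_sums X \<and> formal_le r c d}"

end

(* The order on subdistributions is the existence of a partial coupling: a finitely supported
   transport plan on r whose row sums are mu and whose column sums are at most nu. Couplings
   compose by gluing, which gives transitivity; they do not decrease the mass of up-sets, which
   gives antisymmetry; and splitting the weights of two formal sums according to a coupling
   yields the common subdivision. Every axiom respects the order under evaluation of terms. Conversely,
   a term is derivably equal to the combination of its variables weighted by its value, and a coupling
   provides a combination of pairs (x, y) in r through which monotonicity and the weight axiom
   derive the inequation. *)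
theory Submission
  imports Defs
begin


section \<open>Couplings\<close>

text \<open>Composing two instances of \<open>formal_le\<close> directly would require a common
  refinement of two unrelated subdivisions of the middle sum, and a subdistribution has many
  representing formal sums. A coupling refers only to the subdistributions themselves, which removes
  both difficulties. Mass may be added on the way up, as the weight axiom allows; this is why rows
  are exact while columns are only bounded. The price is division by masses that may vanish: a
  quotient by 0 is 0, so wherever an exact cancellation is wanted, the coupling must be shown to
  carry no mass at that point.\<close>

definition is_coupling :: "'a rel \<Rightarrow> 'a set \<Rightarrow> ('a \<Rightarrow> 'a \<Rightarrow> real) \<Rightarrow> ('a \<Rightarrow> real) \<Rightarrow> ('a \<Rightarrow> real) \<Rightarrow> bool" where
  "is_coupling r F \<gamma> \<mu> \<nu> \<longleftrightarrow>
    finite F \<and> (\<forall>x y. 0 \<le> \<gamma> x y) \<and> (\<forall>x y. \<gamma> x y \<noteq> 0 \<longrightarrow> x \<in> F \<and> y \<in> F \<and> (x, y) \<in> r) \<and>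
    (\<forall>x. \<mu> x = (\<Sum>y\<in>F. \<gamma> x y)) \<and> (\<forall>y. (\<Sum>x\<in>F. \<gamma> x y) \<le> \<nu> y)"

definition coupling_le :: "'a rel \<Rightarrow> ('a \<Rightarrow> real) \<Rightarrow> ('a \<Rightarrow> real) \<Rightarrow> bool" where
  "coupling_le r \<mu> \<nu> \<longleftrightarrow> (\<exists>F \<gamma>. is_coupling r F \<gamma> \<mu> \<nu>)"

text \<open>The set \<open>F\<close> merely has to contain the support of the plan, so enlarging it
  adds zeros. This brings two couplings to a common index set before they are added, glued or
  compared.\<close>

lemma is_coupling_superset:
  assumes "is_coupling r F \<gamma> \<mu> \<nu>" "F \<subseteq> G" "finite G"
  shows "is_coupling r G \<gamma> \<mu> \<nu>"
proof -
  have "(\<Sum>y\<in>G. \<gamma> x y) = (\<Sum>y\<in>F. \<gamma> x y)" "(\<Sum>y\<in>G. \<gamma> y x) = (\<Sum>y\<in>F. \<gamma> y x)" for x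
    using assms unfolding is_coupling_def by (intro sum.mono_neutral_right; blast)+
  then show ?thesis
    using assms unfolding is_coupling_def by auto
qed

text \<open>The diagonal plan leaves all mass in place. Reflexivity is asked for on the support
  only, because the order of the poset is reflexive only on its carrier.\<close>

lemma coupling_le_if_le:
  assumes "finite {x. \<mu> x \<noteq> 0}" "\<And>x. \<mu> x \<noteq> 0 \<Longrightarrow> (x, x) \<in> r" "\<And>x. 0 \<le> \<mu> x" "\<And>x. \<mu> x \<le> \<nu> x"
  shows "coupling_le r \<mu> \<nu>"
proof -
  define F where "F = {x. \<mu> x \<noteq> 0}"
  have [simp]: "finite F" using assms(1) by (simp add: F_def)
  have "is_coupling r F (\<lambda>x y. if x = y then \<mu> x else 0) \<mu> \<nu>"
    unfolding is_coupling_def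
  proof (intro conjI allI impI)
    show "(\<Sum>x\<in>F. if x = y then \<mu> x else 0) \<le> \<nu> y" for y
      using order_trans[OF assms(3,4)] assms(4) by (simp add: sum.delta)
    show "\<mu> x = (\<Sum>y\<in>F. if x = y then \<mu> x else 0)" for x
      using assms(1) by (auto simp: sum.delta' F_def)
  qed (use assms in \<open>auto simp: F_def split: if_splits\<close>)
  then show ?thesis unfolding coupling_le_def by blast
qed

section \<open>Couplings of weighted sums\<close>

lemma coupling_le_scale:
  assumes "coupling_le r \<mu> \<nu>" "0 \<le> p"
  shows "coupling_le r (\<lambda>x. p * \<mu> x) (\<lambda>x. p * \<nu> x)"
proof -
  obtain F \<gamma> where "is_coupling r F \<gamma> \<mu> \<nu>"
    using assms(1) unfolding coupling_le_def by blast
  then have "is_coupling r F (\<lambda>x y. p * \<gamma> x y) (\<lambda>x. p * \<mu> x) (\<lambda>x. p * \<nu> x)"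
    using assms(2) unfolding is_coupling_def
    by (auto simp: sum_distrib_left[symmetric] intro: mult_left_mono)
  then show ?thesis unfolding coupling_le_def by blast
qed

lemma coupling_le_add:
  assumes "coupling_le r \<mu> \<nu>" "coupling_le r \<mu>' \<nu>'"
  shows "coupling_le r (\<lambda>x. \<mu> x + \<mu>' x) (\<lambda>x. \<nu> x + \<nu>' x)"
proof -
  obtain F \<gamma> G \<delta> where *: "is_coupling r F \<gamma> \<mu> \<nu>" "is_coupling r G \<delta> \<mu>' \<nu>'"
    using assms unfolding coupling_le_def by blast
  then have "finite (F \<union> G)" unfolding is_coupling_def by blast
  with * have "is_coupling r (F \<union> G) \<gamma> \<mu> \<nu>" "is_coupling r (F \<union> G) \<delta> \<mu>' \<nu>'"
    by (meson is_coupling_superset sup_ge1 sup_ge2)+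
  then have "is_coupling r (F \<union> G) (\<lambda>x y. \<gamma> x y + \<delta> x y) (\<lambda>x. \<mu> x + \<mu>' x) (\<lambda>x. \<nu> x + \<nu>' x)"
    unfolding is_coupling_def
  proof (elim conjE, intro conjI allI impI)
    fix x y
    assume supp: "\<forall>x y. \<gamma> x y \<noteq> 0 \<longrightarrow> x \<in> F \<union> G \<and> y \<in> F \<union> G \<and> (x, y) \<in> r"
      "\<forall>x y. \<delta> x y \<noteq> 0 \<longrightarrow> x \<in> F \<union> G \<and> y \<in> F \<union> G \<and> (x, y) \<in> r"
      and "\<gamma> x y + \<delta> x y \<noteq> 0"
    then have "\<gamma> x y \<noteq> 0 \<or> \<delta> x y \<noteq> 0" by auto
    with supp show "x \<in> F \<union> G" "y \<in> F \<union> G" "(x, y) \<in> r" by blast+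
  qed (auto simp: sum.distrib intro: add_mono)
  then show ?thesis unfolding coupling_le_def by blast
qed

lemma coupling_le_zero: "coupling_le r (\<lambda>x. 0) (\<lambda>x. 0)"
  by (rule coupling_le_if_le) auto

text \<open>This is the monotonicity of the operations with respect to couplings; it interprets the
  rule \<open>mon\<close> in the soundness proof.\<close>

lemma coupling_le_sum:
  assumes "finite I" "\<And>i. i \<in> I \<Longrightarrow> 0 \<le> p i \<and> coupling_le r (\<mu> i) (\<nu> i)"
  shows "coupling_le r (\<lambda>x. \<Sum>i\<in>I. p i * \<mu> i x) (\<lambda>x. \<Sum>i\<in>I. p i * \<nu> i x)"
  using assms
proof (induction I rule: finite_induct)
  case empty
  show ?case by (simp add: coupling_le_zero)
next
  case (insert i I)
  then have "coupling_le r (\<lambda>x. p i * \<mu> i x) (\<lambda>x. p i * \<nu> i x)"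
    by (intro coupling_le_scale) auto
  from coupling_le_add[OF this insert.IH] insert show ?case by simp
qed

lemma coupling_le_trans:
  assumes "trans r" "coupling_le r \<mu> \<nu>" "coupling_le r \<nu> \<rho>"
  shows "coupling_le r \<mu> \<rho>"
proof -
  obtain G \<gamma> H \<delta> where *: "is_coupling r G \<gamma> \<mu> \<nu>" "is_coupling r H \<delta> \<nu> \<rho>"
    using assms unfolding coupling_le_def by blast
  define F where "F = G \<union> H"
  have "finite F" using * unfolding is_coupling_def F_def by blast
  with * have \<gamma>: "is_coupling r F \<gamma> \<mu> \<nu>" and \<delta>: "is_coupling r F \<delta> \<nu> \<rho>"
    unfolding F_def by (meson is_coupling_superset sup_ge1 sup_ge2)+
  have \<nu>0: "0 \<le> \<nu> y" for y
    using \<delta> unfolding is_coupling_def by (simp add: sum_nonneg)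
  have g0: "0 \<le> \<gamma> x y" "0 \<le> \<delta> x y" for x y
    using \<gamma> \<delta> unfolding is_coupling_def by auto
  have row\<delta>: "(\<Sum>z\<in>F. \<delta> y z) = \<nu> y" for y
    using \<delta> unfolding is_coupling_def by simp
  have col\<gamma>: "(\<Sum>x\<in>F. \<gamma> x y) \<le> \<nu> y" for y
    using \<gamma> unfolding is_coupling_def by simp
  have \<gamma>_le: "\<gamma> x y \<le> \<nu> y" if "x \<in> F" for x y
    using member_le_sum[of x F "\<lambda>x. \<gamma> x y"] that g0 \<open>finite F\<close> col\<gamma>[of y] by force
  \<comment> \<open>At \<open>\<nu> y = 0\<close> the left side is 0, so the claim is that column
    \<open>y\<close> of \<open>\<gamma>\<close> vanishes; it does, being nonnegative with sum at
    most \<open>\<nu> y\<close>.\<close>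
  have cancel: "\<gamma> x y * \<nu> y / \<nu> y = \<gamma> x y" for x y
  proof (cases "\<nu> y = 0")
    case True
    then have "\<gamma> x y = 0"
      using \<gamma>_le[of x y] g0(1)[of x y] \<gamma> unfolding is_coupling_def by fastforce
    then show ?thesis by simp
  qed simp
  \<comment> \<open>Gluing along the middle: the mass that \<open>\<gamma>\<close> delivers from
    \<open>x\<close> to \<open>y\<close> is forwarded to \<open>z\<close> in the proportion
    \<open>\<delta> y z / \<nu> y\<close>.\<close>
  define \<epsilon> where "\<epsilon> x z = (\<Sum>y\<in>F. \<gamma> x y * \<delta> y z / \<nu> y)" for x z
  have "is_coupling r F \<epsilon> \<mu> \<rho>"
    unfolding is_coupling_def
  proof (intro conjI allI impI)
    show "finite F" by fact
    show "0 \<le> \<epsilon> x z" for x z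
      unfolding \<epsilon>_def by (intro sum_nonneg divide_nonneg_nonneg mult_nonneg_nonneg g0 \<nu>0)
    show "x \<in> F" "z \<in> F" "(x, z) \<in> r" if nz: "\<epsilon> x z \<noteq> 0" for x z
    proof -
      obtain y where "\<gamma> x y * \<delta> y z / \<nu> y \<noteq> 0"
        using sum.not_neutral_contains_not_neutral[OF nz[unfolded \<epsilon>_def]] by blast
      then have "\<gamma> x y \<noteq> 0" "\<delta> y z \<noteq> 0" by auto
      then show "x \<in> F" "z \<in> F" "(x, z) \<in> r"
        using \<gamma> \<delta> \<open>trans r\<close> unfolding is_coupling_def trans_def by blast+
    qed
    show "\<mu> x = (\<Sum>z\<in>F. \<epsilon> x z)" for x
    proof -
      have "(\<Sum>z\<in>F. \<epsilon> x z) = (\<Sum>y\<in>F. \<Sum>z\<in>F. \<gamma> x y * \<delta> y z / \<nu> y)"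
        unfolding \<epsilon>_def by (rule sum.swap)
      also have "\<dots> = (\<Sum>y\<in>F. \<gamma> x y * (\<Sum>z\<in>F. \<delta> y z) / \<nu> y)"
        by (simp add: sum_distrib_left sum_divide_distrib)
      also have "\<dots> = \<mu> x"
        using \<gamma> by (simp add: row\<delta> cancel is_coupling_def)
      finally show ?thesis by simp
    qed
    show "(\<Sum>x\<in>F. \<epsilon> x z) \<le> \<rho> z" for z
    proof -
      have "(\<Sum>x\<in>F. \<epsilon> x z) = (\<Sum>y\<in>F. \<Sum>x\<in>F. \<gamma> x y * \<delta> y z / \<nu> y)"
        unfolding \<epsilon>_def by (rule sum.swap)
      also have "\<dots> = (\<Sum>y\<in>F. (\<Sum>x\<in>F. \<gamma> x y) * (\<delta> y z / \<nu> y))"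
        by (simp add: sum_distrib_right sum_divide_distrib)
      also have "\<dots> \<le> (\<Sum>y\<in>F. \<delta> y z)"
      proof (rule sum_mono)
        fix y
        have "(\<Sum>x\<in>F. \<gamma> x y) * (\<delta> y z / \<nu> y) \<le> \<nu> y * (\<delta> y z / \<nu> y)"
          using col\<gamma> g0 \<nu>0 by (intro mult_right_mono) auto
        \<comment> \<open>An equality for \<open>\<nu> y \<noteq> 0\<close>; otherwise the left side
          is 0 and nonnegativity of \<open>\<delta>\<close> suffices.\<close>
        also have "\<dots> \<le> \<delta> y z" using g0 by simp
        finally show "(\<Sum>x\<in>F. \<gamma> x y) * (\<delta> y z / \<nu> y) \<le> \<delta> y z" .
      qed
      also have "\<dots> \<le> \<rho> z" using \<delta> unfolding is_coupling_def by simp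
      finally show ?thesis .
    qed
  qed
  then show ?thesis unfolding coupling_le_def by blast
qed

text \<open>Mass that starts in the up-closed set \<open>U\<close> also arrives in \<open>U\<close>.
  The rows of \<open>U\<close> are therefore covered by the columns of \<open>U\<close>, and these
  are bounded by \<open>\<nu>\<close>.\<close>

lemma coupling_le_upset_sum:
  assumes "is_coupling r F \<gamma> \<mu> \<nu>" "\<And>x y. x \<in> U \<Longrightarrow> (x, y) \<in> r \<Longrightarrow> y \<in> U"
  shows "(\<Sum>x\<in>F \<inter> U. \<mu> x) \<le> (\<Sum>x\<in>F \<inter> U. \<nu> x)"
proof -
  have fin: "finite F" and g0: "\<And>x y. 0 \<le> \<gamma> x y"
    using assms(1) unfolding is_coupling_def by auto
  have "(\<Sum>x\<in>F \<inter> U. \<mu> x) = (\<Sum>x\<in>F \<inter> U. \<Sum>y\<in>F. \<gamma> x y)"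
    using assms(1) unfolding is_coupling_def by simp
  also have "\<dots> = (\<Sum>x\<in>F \<inter> U. \<Sum>y\<in>F \<inter> U. \<gamma> x y)"
  proof (rule sum.cong[OF refl])
    fix x assume "x \<in> F \<inter> U"
    then have "\<forall>y\<in>F - F \<inter> U. \<gamma> x y = 0"
      using assms unfolding is_coupling_def by blast
    then show "sum (\<gamma> x) F = sum (\<gamma> x) (F \<inter> U)"
      using fin by (intro sum.mono_neutral_right) auto
  qed
  also have "\<dots> = (\<Sum>y\<in>F \<inter> U. \<Sum>x\<in>F \<inter> U. \<gamma> x y)"
    by (rule sum.swap)
  also have "\<dots> \<le> (\<Sum>y\<in>F \<inter> U. \<Sum>x\<in>F. \<gamma> x y)"
    by (intro sum_mono sum_mono2 fin g0) auto
  also have "\<dots> \<le> (\<Sum>y\<in>F \<inter> U. \<nu> y)"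
    using assms(1) unfolding is_coupling_def by (intro sum_mono) auto
  finally show ?thesis .
qed

text \<open>The two couplings make the masses of all up-closed sets agree. The principal up-set of
  \<open>x\<close> stays up-closed when \<open>x\<close> is removed, by antisymmetry, so subtracting
  the two masses isolates the value at \<open>x\<close>.\<close>

lemma coupling_le_antisym:
  assumes "trans r" "antisym r" "coupling_le r \<mu> \<nu>" "coupling_le r \<nu> \<mu>"
  shows "\<mu> = \<nu>"
proof
  fix x
  obtain G \<gamma> H \<delta> where *: "is_coupling r G \<gamma> \<mu> \<nu>" "is_coupling r H \<delta> \<nu> \<mu>"
    using assms unfolding coupling_le_def by blast
  \<comment> \<open>Including \<open>x\<close> ensures that the two restricted up-sets differ by
    exactly \<open>x\<close>, even if neither coupling touches it.\<close>
  define F where "F = insert x (G \<union> H)"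
  have "finite F" using * unfolding is_coupling_def F_def by blast
  then have \<gamma>: "is_coupling r F \<gamma> \<mu> \<nu>" and \<delta>: "is_coupling r F \<delta> \<nu> \<mu>"
    unfolding F_def using * by (blast intro: is_coupling_superset)+
  have eq: "(\<Sum>y\<in>F \<inter> U. \<mu> y) = (\<Sum>y\<in>F \<inter> U. \<nu> y)" if "\<And>x y. x \<in> U \<Longrightarrow> (x, y) \<in> r \<Longrightarrow> y \<in> U" for U
    using coupling_le_upset_sum[OF \<gamma>, of U] coupling_le_upset_sum[OF \<delta>, of U] that by force
  define V where "V = {y. (x, y) \<in> r \<and> y \<noteq> x}"
  have "(\<Sum>y\<in>F \<inter> insert x V. \<mu> y) = (\<Sum>y\<in>F \<inter> insert x V. \<nu> y)"
    using \<open>trans r\<close> by (intro eq) (auto simp: V_def dest: transD)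
  moreover have "(\<Sum>y\<in>F \<inter> V. \<mu> y) = (\<Sum>y\<in>F \<inter> V. \<nu> y)"
    using \<open>trans r\<close> \<open>antisym r\<close> by (intro eq) (auto simp: V_def dest: transD antisymD)
  moreover have "F \<inter> insert x V = insert x (F \<inter> V)" "x \<notin> F \<inter> V"
    by (auto simp: F_def V_def)
  ultimately show "\<mu> x = \<nu> x"
    using \<open>finite F\<close> by simp
qed


section \<open>Formal sums and subdivisions\<close>

lemma subdist_of_alt: "subdist_of c x = (\<Sum>i<length c. if snd (c ! i) = x then fst (c ! i) else 0)"
  unfolding subdist_of_def by (simp add: sum.inter_filter[symmetric])

lemma subdist_of_Nil [simp]: "subdist_of [] x = 0"
  by (simp add: subdist_of_alt)

lemma subdist_of_Cons [simp]:
  "subdist_of (p # c) x = (if snd p = x then fst p else 0) + subdist_of c x"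
  by (simp add: subdist_of_alt sum.lessThan_Suc_shift del: sum.lessThan_Suc cong: if_cong)

lemma subdist_of_append [simp]: "subdist_of (c @ d) x = subdist_of c x + subdist_of d x"
  by (induction c) auto

lemma subdist_of_eq_0: "x \<notin> snd ` set c \<Longrightarrow> subdist_of c x = 0"
  by (induction c) auto

lemma formal_sums_nth:
  assumes "c \<in> formal_sums X" "i < length c"
  shows "0 < fst (c ! i)" "fst (c ! i) \<le> 1" "snd (c ! i) \<in> X"
proof -
  have "c ! i \<in> {0<..1} \<times> X"
    using assms nth_mem[OF assms(2)] unfolding formal_sums_def by blast
  then show "0 < fst (c ! i)" "fst (c ! i) \<le> 1" "snd (c ! i) \<in> X" by auto
qed

lemma subdist_of_nonneg: "c \<in> formal_sums X \<Longrightarrow> 0 \<le> subdist_of c x"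
  unfolding subdist_of_alt by (intro sum_nonneg) (simp add: formal_sums_nth(1) less_imp_le)

lemma fst_le_subdist_of:
  assumes "c \<in> formal_sums X" "i < length c"
  shows "fst (c ! i) \<le> subdist_of c (snd (c ! i))"
  unfolding subdist_of_def using assms
  by (intro member_le_sum) (auto intro: less_imp_le formal_sums_nth(1))

text \<open>Summands at the same point are collected, and further points of \<open>F\<close>
  contribute 0. With a quotient of a coupling by a marginal as \<open>g\<close>, this evaluates the
  row and column sums of the split weights in \<open>formal_le_if_coupling_le\<close>.\<close>

lemma sum_nth_eq_sum_subdist_of:
  assumes "finite F" "snd ` set c \<subseteq> F"
  shows "(\<Sum>i<length c. fst (c ! i) * g (snd (c ! i))) = (\<Sum>x\<in>F. subdist_of c x * g x)"
  using assms
proof (induction c)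
  case (Cons p c)
  have "(\<Sum>x\<in>F. (if snd p = x then fst p else 0) * g x) = fst p * g (snd p)"
    using Cons.prems by (simp add: if_distrib if_distribR sum.delta cong: if_cong)
  with Cons show ?case
    by (simp add: sum.lessThan_Suc_shift distrib_right sum.distrib del: sum.lessThan_Suc)
qed simp

lemma sum_subdist_of:
  assumes "finite F" "snd ` set c \<subseteq> F"
  shows "(\<Sum>x\<in>F. subdist_of c x) = sum_list (map fst c)"
  using sum_nth_eq_sum_subdist_of[OF assms, of "\<lambda>_. 1"]
  by (simp add: sum_list_sum_nth atLeast0LessThan)

lemma subdist_of_map:
  "distinct L \<Longrightarrow> subdist_of (map (\<lambda>l. (g l, h l)) L) x = (\<Sum>l\<in>set L. if h l = x then g l else 0)"
  by (induction L) auto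

lemma subdistsI:
  assumes "finite F" "F \<subseteq> X" "\<And>x. 0 \<le> \<mu> x" "\<And>x. x \<notin> F \<Longrightarrow> \<mu> x = 0" "sum \<mu> F \<le> 1"
  shows "\<mu> \<in> subdists X"
proof -
  have supp: "{x. \<mu> x \<noteq> 0} \<subseteq> F" using assms(4) by blast
  have "\<mu> x \<le> 1" for x
  proof (cases "x \<in> F")
    case True
    then have "\<mu> x \<le> sum \<mu> F" using assms(1,3) by (intro member_le_sum)
    then show ?thesis using assms(5) by simp
  qed (simp add: assms(4))
  moreover have "(\<Sum>x | \<mu> x \<noteq> 0. \<mu> x) \<le> sum \<mu> F"
    using supp assms(1,3) by (intro sum_mono2) auto
  ultimately show ?thesis
    using assms supp finite_subset[OF supp] by (auto simp: subdists_def)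
qed

lemma subdistsD:
  assumes "\<mu> \<in> subdists X"
  shows "0 \<le> \<mu> x" "\<mu> x \<noteq> 0 \<Longrightarrow> x \<in> X" "finite {x. \<mu> x \<noteq> 0}" "finite F \<Longrightarrow> sum \<mu> F \<le> 1"
proof -
  show "0 \<le> \<mu> x" "\<mu> x \<noteq> 0 \<Longrightarrow> x \<in> X" "finite {x. \<mu> x \<noteq> 0}"
    using assms unfolding subdists_def by auto
  assume F: "finite F"
  have "sum \<mu> F = (\<Sum>x\<in>F \<inter> {x. \<mu> x \<noteq> 0}. \<mu> x)"
    using F by (intro sum.mono_neutral_right) auto
  also have "\<dots> \<le> (\<Sum>x | \<mu> x \<noteq> 0. \<mu> x)"
    using assms unfolding subdists_def by (intro sum_mono2) auto
  finally show "sum \<mu> F \<le> 1" using assms unfolding subdists_def by simp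
qed

lemma subdist_of_image: "subdist_of ` formal_sums X = subdists X"
proof (intro subset_antisym subsetI)
  fix \<mu> assume "\<mu> \<in> subdist_of ` formal_sums X"
  then obtain c where c: "c \<in> formal_sums X" and \<mu>: "\<mu> = subdist_of c" by blast
  show "\<mu> \<in> subdists X"
  proof (rule subdistsI)
    show "finite (snd ` set c)" "snd ` set c \<subseteq> X" "sum \<mu> (snd ` set c) \<le> 1"
      using c by (auto simp: \<mu> sum_subdist_of formal_sums_def)
    show "0 \<le> \<mu> x" "x \<notin> snd ` set c \<Longrightarrow> \<mu> x = 0" for x
      using subdist_of_nonneg[OF c] subdist_of_eq_0[of x c] unfolding \<mu> by auto
  qed
next
  fix \<mu> assume \<mu>: "\<mu> \<in> subdists X"
  then obtain zs where zs: "distinct zs" "set zs = {x. \<mu> x \<noteq> 0}"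
    using finite_distinct_list[of "{x. \<mu> x \<noteq> 0}"] unfolding subdists_def by blast
  define c where "c = map (\<lambda>z. (\<mu> z, z)) zs"
  have "c \<in> formal_sums X"
    using \<mu> zs sum.distinct_set_conv_list[OF zs(1), of \<mu>]
    by (auto simp: formal_sums_def c_def subdists_def comp_def order.strict_iff_order)
  moreover have "\<mu> = subdist_of c"
    by (rule ext) (use zs subdistsD(3)[OF \<mu>] in \<open>auto simp: c_def subdist_of_map sum.delta\<close>)
  ultimately show "\<mu> \<in> subdist_of ` formal_sums X" by blast
qed

lemma subdist_of_subdivision:
  assumes "is_subdivision d c"
  shows "subdist_of d x = subdist_of c x"
proof -
  have block: "subdist_of (map (\<lambda>q. (q, y)) ps) x = (if y = x then sum_list ps else 0)" for y ps
    by (induction ps) auto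
  obtain pss where "length pss = length c" "\<forall>i<length c. sum_list (pss ! i) = fst (c ! i)"
    and d: "d = concat (map2 (\<lambda>ps (p, x). map (\<lambda>q. (q, x)) ps) pss c)"
    using assms unfolding is_subdivision_def by blast
  then show ?thesis
    unfolding d
  proof (induction pss c rule: list_induct2)
    case (Cons ps pss p c)
    have "\<forall>i<length c. sum_list (pss ! i) = fst (c ! i)"
      using Cons.prems by (auto dest: spec[of _ "Suc _"])
    moreover have "sum_list ps = fst p" using Cons.prems(1) by force
    ultimately show ?case using Cons.IH by (cases p) (simp add: block)
  qed simp
qed

lemma fst_subdivision_nonneg:
  assumes "is_subdivision d c"
  shows "\<forall>z\<in>set d. 0 \<le> fst z"
proof -
  obtain pss where pss: "length pss = length c" "\<forall>i<length c. set (pss ! i) \<subseteq> {0<..1}"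
    and d: "d = concat (map2 (\<lambda>ps (p, x). map (\<lambda>q. (q, x)) ps) pss c)"
    using assms unfolding is_subdivision_def by blast
  show ?thesis
    using pss unfolding d
  proof (induction pss c rule: list_induct2)
    case (Cons ps pss p c)
    have "set ps \<subseteq> {0<..1}" using spec[OF Cons.prems(1), of 0] by simp
    then have "\<forall>z\<in>set (map (\<lambda>q. (q, snd p)) ps). 0 \<le> fst z" by auto
    moreover have "set (pss ! i) \<subseteq> {0<..1}" if "i < length c" for i
      using spec[OF Cons.prems(1), of "Suc i"] that by simp
    ultimately show ?case using Cons.IH by (cases p) (simp del: set_concat set_map add: ball_Un)
  qed simp
qed

lemma coupling_le_if_obviously_below:
  assumes "\<forall>z\<in>set c. 0 \<le> fst z" "\<forall>z\<in>set d. 0 \<le> fst z" "obviously_below r c d"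
  shows "coupling_le r (subdist_of c) (subdist_of d)"
proof -
  obtain f where inj: "inj_on f {..<length c}" and f: "f ` {..<length c} \<subseteq> {..<length d}"
    and le: "\<And>i. i < length c \<Longrightarrow> fst (c ! i) \<le> fst (d ! f i) \<and> (snd (c ! i), snd (d ! f i)) \<in> r"
    using assms(3) unfolding obviously_below_def by blast
  have c0: "0 \<le> fst (c ! i)" if "i < length c" for i
    using assms(1) that by simp
  have d0: "0 \<le> fst (d ! i)" if "i < length d" for i
    using assms(2) that by simp
  define F where "F = snd ` set c \<union> snd ` set d"
  have F: "finite F" "\<And>i. i < length c \<Longrightarrow> snd (c ! i) \<in> F" "\<And>i. i < length c \<Longrightarrow> snd (d ! f i) \<in> F"
    using f unfolding F_def by force+
  \<comment> \<open>Each summand of \<open>c\<close> is carried as a whole from its own point to the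
    point of its partner in \<open>d\<close>.\<close>
  define \<gamma> where
    "\<gamma> x y = (\<Sum>i<length c. if snd (c ! i) = x \<and> snd (d ! f i) = y then fst (c ! i) else 0)" for x y
  have "is_coupling r F \<gamma> (subdist_of c) (subdist_of d)"
    unfolding is_coupling_def
  proof (intro conjI allI impI)
    show "finite F" by fact
    show "0 \<le> \<gamma> x y" for x y
      unfolding \<gamma>_def by (intro sum_nonneg) (auto intro: c0)
    fix x y assume "\<gamma> x y \<noteq> 0"
    then obtain i where "i \<in> {..<length c}"
      "(if snd (c ! i) = x \<and> snd (d ! f i) = y then fst (c ! i) else 0) \<noteq> 0"
      unfolding \<gamma>_def by (rule sum.not_neutral_contains_not_neutral)
    then show "x \<in> F" "y \<in> F" "(x, y) \<in> r"
      using F le by (auto split: if_splits)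
  next
    fix x
    have "(\<Sum>y\<in>F. \<gamma> x y)
        = (\<Sum>i<length c. \<Sum>y\<in>F. if snd (c ! i) = x \<and> snd (d ! f i) = y then fst (c ! i) else 0)"
      unfolding \<gamma>_def by (rule sum.swap)
    also have "\<dots> = subdist_of c x"
      unfolding subdist_of_alt using F by (intro sum.cong) (auto simp: sum.delta')
    finally show "subdist_of c x = (\<Sum>y\<in>F. \<gamma> x y)" by simp
  next
    fix y
    have "(\<Sum>x\<in>F. \<gamma> x y)
        = (\<Sum>i<length c. \<Sum>x\<in>F. if snd (c ! i) = x \<and> snd (d ! f i) = y then fst (c ! i) else 0)"
      unfolding \<gamma>_def by (rule sum.swap)
    also have "\<dots> = (\<Sum>i<length c. if snd (d ! f i) = y then fst (c ! i) else 0)"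
      using F by (intro sum.cong) (auto simp: sum.delta')
    also have "\<dots> \<le> (\<Sum>i<length c. if snd (d ! f i) = y then fst (d ! f i) else 0)"
      using le by (intro sum_mono) auto
    \<comment> \<open>Injectivity of \<open>f\<close> enters here: no summand of \<open>d\<close> is
      charged twice.\<close>
    also have "\<dots> = (\<Sum>j\<in>f ` {..<length c}. if snd (d ! j) = y then fst (d ! j) else 0)"
      by (simp add: sum.reindex[OF inj])
    also have "\<dots> \<le> subdist_of d y"
      unfolding subdist_of_alt using f d0 by (intro sum_mono2) auto
    finally show "(\<Sum>x\<in>F. \<gamma> x y) \<le> subdist_of d y" .
  qed
  then show ?thesis unfolding coupling_le_def by blast
qed

lemma coupling_le_if_formal_le:
  assumes "formal_le r c d"
  shows "coupling_le r (subdist_of c) (subdist_of d)"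
proof -
  obtain c' d' where sub: "is_subdivision c' c" "is_subdivision d' d" and ob: "obviously_below r c' d'"
    using assms unfolding formal_le_def by blast
  have "coupling_le r (subdist_of c') (subdist_of d')"
    using sub[THEN fst_subdivision_nonneg] ob by (rule coupling_le_if_obviously_below)
  moreover have "subdist_of c' = subdist_of c" "subdist_of d' = subdist_of d"
    using sub[THEN subdist_of_subdivision] by auto
  ultimately show ?thesis by simp
qed

section \<open>Subdivisions obtained from a coupling\<close>

lemma sum_list_filter_pos:
  assumes "\<And>j. j < m \<Longrightarrow> 0 \<le> (w j :: real)"
  shows "sum_list (map w (filter (\<lambda>j. 0 < w j) [0..<m])) = (\<Sum>j<m. w j)"
proof -
  have "sum_list (map w (filter (\<lambda>j. 0 < w j) [0..<m])) = (\<Sum>j<m. if 0 < w j then w j else 0)"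
    by (simp add: sum_list_map_filter' interv_sum_list_conv_sum_set_nat atLeast0LessThan)
  also have "\<dots> = (\<Sum>j<m. w j)"
    using assms by (intro sum.cong) (auto simp: order.strict_iff_order)
  finally show ?thesis .
qed

text \<open>A matrix with row sums the weights of \<open>c\<close> is a subdivision once its zero
  entries are dropped, as the pieces must be positive. Listing the pieces by their index pairs gives
  them keys, by which the pieces of two subdivisions can be matched.\<close>

lemma is_subdivision_product:
  assumes w0: "\<And>i j. i < length c \<Longrightarrow> j < m \<Longrightarrow> 0 \<le> w i j"
    and w: "\<And>i. i < length c \<Longrightarrow> (\<Sum>j<m. w i j) = fst (c ! i)"
    and c1: "\<And>i. i < length c \<Longrightarrow> fst (c ! i) \<le> 1"
  shows "is_subdivision (map (\<lambda>(i, j). (w i j, snd (c ! i)))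
    (filter (\<lambda>(i, j). 0 < w i j) (List.product [0..<length c] [0..<m]))) c"
  unfolding is_subdivision_def
proof (intro exI[of _ "map (\<lambda>i. map (w i) (filter (\<lambda>j. 0 < w i j) [0..<m])) [0..<length c]"]
    conjI allI impI)
  let ?ps = "\<lambda>i. map (w i) (filter (\<lambda>j. 0 < w i j) [0..<m])"
  show "length (map ?ps [0..<length c]) = length c" by simp
  fix i assume i: "i < length c"
  have "w i j \<le> 1" if "j < m" for j
  proof -
    have "w i j \<le> (\<Sum>j<m. w i j)" using w0[OF i] that by (intro member_le_sum) auto
    then show ?thesis using w[OF i] c1[OF i] by simp
  qed
  then show "set (map ?ps [0..<length c] ! i) \<subseteq> {0<..1}" using i by auto
  show "sum_list (map ?ps [0..<length c] ! i) = fst (c ! i)"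
    using i w0 w by (simp add: sum_list_filter_pos)
next
  let ?ps = "\<lambda>i. map (w i) (filter (\<lambda>j. 0 < w i j) [0..<m])"
  have "map2 (\<lambda>ps (p, x). map (\<lambda>q. (q, x)) ps) (map ?ps [0..<length c]) c
      = map (\<lambda>i. map (\<lambda>j. (w i j, snd (c ! i))) (filter (\<lambda>j. 0 < w i j) [0..<m])) [0..<length c]"
    by (rule nth_equalityI) (auto split: prod.splits)
  \<comment> \<open>\<open>List.product\<close> runs through the pairs row by row, so filtering it
    is the same as concatenating the filtered rows.\<close>
  then show "map (\<lambda>(i, j). (w i j, snd (c ! i)))
      (filter (\<lambda>(i, j). 0 < w i j) (List.product [0..<length c] [0..<m]))
    = concat (map2 (\<lambda>ps (p, x). map (\<lambda>q. (q, x)) ps) (map ?ps [0..<length c]) c)"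
    by (simp add: product_concat_map filter_concat map_concat filter_map comp_def)
qed

text \<open>The injection sends the position of a key in \<open>K\<close> to the position of the
  same key in \<open>L\<close>.\<close>

lemma obviously_below_map:
  assumes "distinct K" "distinct L" "set K \<subseteq> set L"
    and "\<And>k. k \<in> set K \<Longrightarrow> fst (g k) \<le> fst (h k) \<and> (snd (g k), snd (h k)) \<in> r"
  shows "obviously_below r (map g K) (map h L)"
proof -
  have "\<exists>j<length L. L ! j = K ! i" if "i < length K" for i
    using assms(3) that by (metis in_set_conv_nth nth_mem subsetD)
  then obtain f where f: "\<And>i. i < length K \<Longrightarrow> f i < length L \<and> L ! f i = K ! i"
    by metis
  have "inj_on f {..<length K}"
    using f assms(1) by (intro inj_onI) (metis lessThan_iff nth_eq_iff_index_eq)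
  then show ?thesis
    unfolding obviously_below_def using f assms(4) by (intro exI[of _ f]) auto
qed

text \<open>A coupling lives on points, whereas formal sums may repeat points. Its mass is therefore
  spread over pairs of summands, and each resulting cell of positive weight serves as a piece of
  both subdivisions with the same weight.\<close>

lemma formal_le_if_coupling_le:
  assumes c: "c \<in> formal_sums X" and d: "d \<in> formal_sums X"
    and le: "coupling_le r (subdist_of c) (subdist_of d)"
  shows "formal_le r c d"
proof -
  define \<mu> \<nu> where "\<mu> = subdist_of c" and "\<nu> = subdist_of d"
  obtain F0 \<gamma> where cpl0: "is_coupling r F0 \<gamma> \<mu> \<nu>"
    using le unfolding coupling_le_def \<mu>_def \<nu>_def by blast
  define F where "F = F0 \<union> snd ` set c \<union> snd ` set d"
  have fin: "finite F" using cpl0 unfolding F_def is_coupling_def by blast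
  have cpl: "is_coupling r F \<gamma> \<mu> \<nu>"
    using is_coupling_superset[OF cpl0 _ fin] unfolding F_def by blast
  have \<gamma>0: "0 \<le> \<gamma> x y" and \<gamma>r: "\<gamma> x y \<noteq> 0 \<Longrightarrow> (x, y) \<in> r"
    and row: "(\<Sum>y\<in>F. \<gamma> x y) = \<mu> x" and col: "(\<Sum>x\<in>F. \<gamma> x y) \<le> \<nu> y" for x y
    using cpl unfolding is_coupling_def by auto
  \<comment> \<open>Needed for the row sums below, which must come out exactly although they divide
    by \<open>\<nu>\<close>.\<close>
  have \<gamma>_eq_0: "\<gamma> x y = 0" if "\<nu> y = 0" for x y
  proof (cases "x \<in> F")
    case True
    then show ?thesis
      using member_le_sum[of x F "\<lambda>x. \<gamma> x y"] \<gamma>0 fin col[of y] that by (force intro: antisym)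
  next
    case False
    then show ?thesis using cpl unfolding is_coupling_def by blast
  qed
  define n m where "n = length c" and "m = length d"
  define p q x y where "p i = fst (c ! i)" and "q i = fst (d ! i)"
    and "x i = snd (c ! i)" and "y i = snd (d ! i)" for i
  have p: "0 < p i" "p i \<le> 1" "p i \<le> \<mu> (x i)" if "i < n" for i
    using formal_sums_nth[OF c] fst_le_subdist_of[OF c] that
    unfolding p_def x_def \<mu>_def n_def by auto
  have q: "0 < q j" "q j \<le> 1" "q j \<le> \<nu> (y j)" if "j < m" for j
    using formal_sums_nth[OF d] fst_le_subdist_of[OF d] that
    unfolding q_def y_def \<nu>_def m_def by auto
  \<comment> \<open>The mass \<open>\<gamma> (x i) (y j)\<close> is shared among the repeated summands in proportion to their weights.\<close>
  define w where "w i j = p i * q j * \<gamma> (x i) (y j) / (\<mu> (x i) * \<nu> (y j))" for i j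
  have w0: "0 \<le> w i j" if "i < n" "j < m" for i j
    unfolding w_def using p[OF that(1)] q[OF that(2)] \<gamma>0 by (intro divide_nonneg_nonneg mult_nonneg_nonneg) auto
  have wrow: "(\<Sum>j<m. w i j) = p i" if "i < n" for i
  proof -
    have "(\<Sum>j<m. w i j) = p i / \<mu> (x i) * (\<Sum>j<m. q j * (\<gamma> (x i) (y j) / \<nu> (y j)))"
      by (simp add: w_def sum_distrib_left mult_ac)
    also have "(\<Sum>j<m. q j * (\<gamma> (x i) (y j) / \<nu> (y j))) = (\<Sum>z\<in>F. \<nu> z * (\<gamma> (x i) z / \<nu> z))"
      unfolding q_def y_def \<nu>_def m_def
      by (rule sum_nth_eq_sum_subdist_of[OF fin]) (auto simp: F_def)
    also have "\<dots> = (\<Sum>z\<in>F. \<gamma> (x i) z)"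
      using \<gamma>_eq_0 by (intro sum.cong) auto
    also have "\<dots> = \<mu> (x i)" by (rule row)
    finally show ?thesis using p[OF that] by simp
  qed
  have wcol: "(\<Sum>i<n. w i j) \<le> q j" if "j < m" for j
  proof -
    have "(\<Sum>i<n. w i j) = q j / \<nu> (y j) * (\<Sum>i<n. p i * (\<gamma> (x i) (y j) / \<mu> (x i)))"
      by (simp add: w_def sum_distrib_left mult_ac)
    also have "(\<Sum>i<n. p i * (\<gamma> (x i) (y j) / \<mu> (x i))) = (\<Sum>z\<in>F. \<mu> z * (\<gamma> z (y j) / \<mu> z))"
      unfolding p_def x_def \<mu>_def n_def
      by (rule sum_nth_eq_sum_subdist_of[OF fin]) (auto simp: F_def)
    \<comment> \<open>Cancelling \<open>\<mu> z\<close> gives 0 when \<open>\<mu> z = 0\<close>; an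
      upper bound is all that the columns require.\<close>
    also have "q j / \<nu> (y j) * (\<Sum>z\<in>F. \<mu> z * (\<gamma> z (y j) / \<mu> z)) \<le> q j / \<nu> (y j) * (\<Sum>z\<in>F. \<gamma> z (y j))"
      using q[OF that] \<gamma>0 by (intro mult_left_mono sum_mono) auto
    also have "\<dots> \<le> q j / \<nu> (y j) * \<nu> (y j)"
      using q[OF that] col by (intro mult_left_mono) auto
    also have "\<dots> = q j" using q[OF that] by simp
    finally show ?thesis .
  qed
  \<comment> \<open>The weight \<open>q j\<close> is split into the pieces \<open>w i j\<close> with \<open>i < n\<close> and, at index \<open>n\<close>, the remainder.\<close>
  define v where "v j i = (if i < n then w i j else q j - (\<Sum>i<n. w i j))" for j i
  define K where "K = filter (\<lambda>(i, j). 0 < w i j) (List.product [0..<n] [0..<m])"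
  define L where "L = filter (\<lambda>(j, i). 0 < v j i) (List.product [0..<m] [0..<Suc n])"
  have "is_subdivision (map (\<lambda>(i, j). (w i j, snd (c ! i))) K) c"
    unfolding K_def n_def
    by (rule is_subdivision_product) (use w0 wrow p in \<open>auto simp: n_def p_def\<close>)
  moreover have "is_subdivision (map (\<lambda>(j, i). (v j i, snd (d ! j))) L) d"
    unfolding L_def m_def
    by (rule is_subdivision_product) (use w0 wcol q in \<open>auto simp: m_def q_def v_def\<close>)
  moreover have "obviously_below r (map (\<lambda>(i, j). (w i j, snd (c ! i))) K)
      (map (\<lambda>(j, i). (v j i, snd (d ! j))) L)"
  proof -
    \<comment> \<open>The pieces of \<open>c\<close> carry keys \<open>(i, j)\<close> and those of
      \<open>d\<close> keys \<open>(j, i)\<close>; swapping makes the keys comparable.\<close>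
    have "obviously_below r (map (\<lambda>(j, i). (w i j, snd (c ! i))) (map prod.swap K))
        (map (\<lambda>(j, i). (v j i, snd (d ! j))) L)"
    proof (rule obviously_below_map)
      show "distinct (map prod.swap K)" "distinct L"
        unfolding K_def L_def by (auto simp: distinct_map distinct_product)
      show "set (map prod.swap K) \<subseteq> set L"
        unfolding K_def L_def by (auto simp: v_def)
      show "fst (case k of (j, i) \<Rightarrow> (w i j, snd (c ! i))) \<le> fst (case k of (j, i) \<Rightarrow> (v j i, snd (d ! j)))
          \<and> (snd (case k of (j, i) \<Rightarrow> (w i j, snd (c ! i))), snd (case k of (j, i) \<Rightarrow> (v j i, snd (d ! j)))) \<in> r"
        if k: "k \<in> set (map prod.swap K)" for k
      proof -
        obtain i j where ij: "k = (j, i)" "i < n" "j < m" "0 < w i j"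
          using k unfolding K_def by auto
        then have "\<gamma> (x i) (y j) \<noteq> 0" unfolding w_def by auto
        then show ?thesis using ij \<gamma>r by (simp add: v_def x_def y_def)
      qed
    qed
    then show ?thesis by (simp add: comp_def case_prod_unfold)
  qed
  ultimately show ?thesis unfolding formal_le_def by blast
qed

section \<open>The order on subdistributions, independently of representatives\<close>

lemma formal_le_iff_coupling_le:
  "c \<in> formal_sums X \<Longrightarrow> d \<in> formal_sums X \<Longrightarrow>
    formal_le r c d \<longleftrightarrow> coupling_le r (subdist_of c) (subdist_of d)"
  using formal_le_if_coupling_le coupling_le_if_formal_le by blast

text \<open>\<open>subdist_order\<close> asks for some pair of representing formal sums, while a
  coupling mentions none; hence any pair of representatives decides the order.\<close>

lemma subdist_order_iff:
  "(\<mu>, \<nu>) \<in> subdist_order X r \<longleftrightarrow> \<mu> \<in> subdists X \<and> \<nu> \<in> subdists X \<and> coupling_le r \<mu> \<nu>"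
proof
  assume "(\<mu>, \<nu>) \<in> subdist_order X r"
  then show "\<mu> \<in> subdists X \<and> \<nu> \<in> subdists X \<and> coupling_le r \<mu> \<nu>"
    unfolding subdist_order_def subdist_of_image[symmetric]
    by (auto intro: coupling_le_if_formal_le)
next
  assume "\<mu> \<in> subdists X \<and> \<nu> \<in> subdists X \<and> coupling_le r \<mu> \<nu>"
  then obtain c d where "c \<in> formal_sums X" "d \<in> formal_sums X" "\<mu> = subdist_of c" "\<nu> = subdist_of d"
      and "coupling_le r (subdist_of c) (subdist_of d)"
    unfolding subdist_of_image[symmetric] by blast
  then show "(\<mu>, \<nu>) \<in> subdist_order X r"
    unfolding subdist_order_def using formal_le_if_coupling_le by blast
qed

lemma partial_order_on_subdist_order:
  assumes "partial_order_on X r"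
  shows "partial_order_on (subdists X) (subdist_order X r)"
proof -
  have r: "refl_on X r" "trans r" "antisym r"
    using assms by (auto simp: order_on_defs)
  have "coupling_le r \<mu> \<mu>" if "\<mu> \<in> subdists X" for \<mu>
    using that r(1) by (intro coupling_le_if_le) (auto simp: subdists_def refl_on_def)
  then show ?thesis
    unfolding partial_order_on_def preorder_on_def
    using coupling_le_trans[OF r(2)] coupling_le_antisym[OF r(2,3)]
    by (auto simp: subdist_order_iff refl_on_def intro!: transI antisymI)
qed


section \<open>Evaluation of terms and soundness\<close>

lemma subconvexI:
  assumes "\<And>p. p \<in> set ps \<Longrightarrow> 0 \<le> p" "sum_list ps \<le> 1"
  shows "subconvex ps"
proof -
  have le: "p \<le> sum_list ps" if p: "p \<in> set ps" for p
  proof -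
    obtain i where i: "i < length ps" "ps ! i = p" using p by (auto simp: in_set_conv_nth)
    have "ps ! i \<le> (\<Sum>j<length ps. ps ! j)"
      using i(1) assms(1) by (intro member_le_sum) auto
    then show ?thesis using i(2) by (simp add: sum_list_sum_nth atLeast0LessThan)
  qed
  show ?thesis
    unfolding subconvex_def using assms order_trans[OF le assms(2)] by auto
qed

lemma subconvex_nth:
  assumes "subconvex ps" "i < length ps"
  shows "0 \<le> ps ! i"
proof -
  have "ps ! i \<in> {0..1}"
    using assms nth_mem[OF assms(2)] unfolding subconvex_def by blast
  then show ?thesis by simp
qed

lemma subconvex_combination_in_subdists:
  assumes ps: "subconvex ps" and \<mu>: "\<And>i. i < length ps \<Longrightarrow> \<mu> i \<in> subdists X"
  shows "(\<lambda>x. \<Sum>i<length ps. ps ! i * \<mu> i x) \<in> subdists X"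
proof (rule subdistsI)
  define F where "F = (\<Union>i<length ps. {x. \<mu> i x \<noteq> 0})"
  show fin: "finite F" using subdistsD(3)[OF \<mu>] by (auto simp: F_def)
  show "F \<subseteq> X" using subdistsD(2)[OF \<mu>] by (auto simp: F_def)
  show "0 \<le> (\<Sum>i<length ps. ps ! i * \<mu> i x)" for x
    using subconvex_nth[OF ps] subdistsD(1)[OF \<mu>] by (intro sum_nonneg mult_nonneg_nonneg) auto
  show "(\<Sum>i<length ps. ps ! i * \<mu> i x) = 0" if "x \<notin> F" for x
    using that by (intro sum.neutral) (auto simp: F_def)
  have "(\<Sum>x\<in>F. \<Sum>i<length ps. ps ! i * \<mu> i x) = (\<Sum>i<length ps. ps ! i * sum (\<mu> i) F)"
    by (subst sum.swap) (simp add: sum_distrib_left)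
  also have "\<dots> \<le> (\<Sum>i<length ps. ps ! i * 1)"
    using subconvex_nth[OF ps] subdistsD(4)[OF \<mu> fin] by (intro sum_mono mult_left_mono) auto
  also have "\<dots> \<le> 1"
    using ps by (simp add: subconvex_def sum_list_sum_nth atLeast0LessThan)
  finally show "(\<Sum>x\<in>F. \<Sum>i<length ps. ps ! i * \<mu> i x) \<le> 1" .
qed

lemma Op_in_terms_iff:
  "Op ps ts \<in> terms subconvex_theory X \<longleftrightarrow>
    subconvex ps \<and> length ts = length ps \<and> set ts \<subseteq> terms subconvex_theory X"
  by (subst terms.simps) (auto simp: subconvex_theory_def)

lemma set2_trm_subset: "t \<in> terms T X \<Longrightarrow> set2_trm t \<subseteq> X"
  by (induction t rule: terms.induct) auto

lemma finite_set2_trm: "finite (set2_trm t)"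
  by (induction t) auto

text \<open>The interpretation of terms in the subdistributions that extends the Dirac unit. The
  form \<open>map eval ts ! i\<close> is what primitive recursion through lists accepts;
  \<open>eval_Op\<close> is the version used once the lengths agree.\<close>

primrec eval :: "(real list, 'a) trm \<Rightarrow> 'a \<Rightarrow> real" where
  "eval (Var x) = (\<lambda>y. if y = x then 1 else 0)"
| "eval (Op ps ts) = (\<lambda>y. \<Sum>i<length ps. ps ! i * (map eval ts ! i) y)"

lemma eval_Op:
  "length ts = length ps \<Longrightarrow> eval (Op ps ts) = (\<lambda>y. \<Sum>i<length ps. ps ! i * eval (ts ! i) y)"
  by (intro ext) simp

declare eval.simps(2) [simp del]

lemma eval_in_subdists:
  assumes "t \<in> terms subconvex_theory X"
  shows "eval t \<in> subdists X"
  using assms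
proof (induction t rule: terms.induct)
  case (Var x)
  then show ?case by (intro subdistsI[of "{x}"]) auto
next
  case (Op ps ts)
  then show ?case
    by (simp add: eval_Op subconvex_theory_def subconvex_combination_in_subdists)
qed

lemma eval_Op_Var:
  assumes "length xs = length ps"
  shows "eval (Op ps (map Var xs)) = subdist_of (zip ps xs)"
  by (rule ext) (use assms in \<open>simp add: eval_Op subdist_of_alt if_distrib eq_commute cong: if_cong\<close>)

section \<open>Soundness of the axioms and of derivations\<close>

lemma subst_comb: "subst \<sigma> (comb ps) = Op ps (map \<sigma> [0..<length ps])"
  by (simp add: comb_def comp_def)

lemma set2_trm_comb: "set2_trm (comb ps) = {..<length ps}"
  by (auto simp: comb_def)

lemma eval_subst_comb: "eval (subst \<sigma> (comb ps)) = (\<lambda>y. \<Sum>i<length ps. ps ! i * eval (\<sigma> i) y)"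
  by (simp add: subst_comb eval_Op)

lemma eval_subst_projection:
  assumes "(s, t) \<in> projection_eqs"
  shows "eval (subst \<sigma> s) = eval (subst \<sigma> t)"
  using assms unfolding projection_eqs_def
  by (auto simp: eval_subst_comb if_distrib if_distribR sum.delta cong: if_cong)

lemma eval_subst_composition:
  assumes "(s, t) \<in> composition_eqs"
  shows "eval (subst \<sigma> s) = eval (subst \<sigma> t)"
proof -
  obtain ps qss m where s: "s = Op ps (map comb qss)"
    and t: "t = comb (map (\<lambda>k. \<Sum>i<length ps. ps ! i * qss ! i ! k) [0..<m])"
    and len: "length qss = length ps" "\<forall>qs\<in>set qss. length qs = m"
    using assms unfolding composition_eqs_def by auto
  show ?thesis
  proof
    fix y
    have "eval (subst \<sigma> s) y = (\<Sum>i<length ps. ps ! i * (\<Sum>k<m. qss ! i ! k * eval (\<sigma> k) y))"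
      using len by (simp add: s eval_Op eval_subst_comb)
    also have "\<dots> = (\<Sum>k<m. (\<Sum>i<length ps. ps ! i * qss ! i ! k) * eval (\<sigma> k) y)"
      by (simp add: sum_distrib_left sum_distrib_right mult.assoc) (rule sum.swap)
    also have "\<dots> = eval (subst \<sigma> t) y"
      by (simp add: t eval_subst_comb)
    finally show "eval (subst \<sigma> s) y = eval (subst \<sigma> t) y" .
  qed
qed

text \<open>Together with \<open>eval_subst_composition\<close> this puts both sides of a
  composition axiom into the subdistributions, as the diagonal coupling requires.\<close>

lemma composition_in_subdists:
  assumes "(s, t) \<in> composition_eqs" "\<forall>v\<in>set2_trm s. \<sigma> v \<in> terms subconvex_theory X"
  shows "eval (subst \<sigma> s) \<in> subdists X"
proof -
  obtain ps qss where s: "s = Op ps (map comb qss)"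
    and ps: "subconvex ps" "length qss = length ps" "\<forall>qs\<in>set qss. subconvex qs"
    using assms(1) unfolding composition_eqs_def by auto
  have "subst \<sigma> (comb qs) \<in> terms subconvex_theory X" if "qs \<in> set qss" for qs
    using that ps(3) assms(2) by (auto simp: s subst_comb Op_in_terms_iff set2_trm_comb)
  then show ?thesis
    using ps by (intro eval_in_subdists) (auto simp: s Op_in_terms_iff)
qed

lemma coupling_le_if_le_subdist:
  assumes "refl_on X r" "\<mu> \<in> subdists X" "\<And>x. \<mu> x \<le> \<nu> x"
  shows "coupling_le r \<mu> \<nu>"
  using assms subdistsD[OF assms(2)] by (intro coupling_le_if_le) (auto simp: refl_on_def)

text \<open>Each axiom evaluates to a pointwise inequality, an equality in the equational cases, so
  the diagonal coupling suffices. For an equation, membership in the subdistributions is checked on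
  the side where it is easier: the variable or the nested combination.\<close>

lemma coupling_le_eval_subst_inequation:
  assumes "refl_on X r" and st: "(s, t) \<in> inequations subconvex_theory"
    and \<sigma>: "\<forall>v \<in> set2_trm s \<union> set2_trm t. \<sigma> v \<in> terms subconvex_theory X"
  shows "coupling_le r (eval (subst \<sigma> s)) (eval (subst \<sigma> t))"
proof (rule coupling_le_if_le_subdist[OF assms(1)])
  have comb: "eval (subst \<sigma> (comb ps)) \<in> subdists X"
    if "subconvex ps" "\<forall>i<length ps. \<sigma> i \<in> terms subconvex_theory X" for ps
    using that unfolding eval_subst_comb
    by (intro subconvex_combination_in_subdists eval_in_subdists) auto
  have "eval (subst \<sigma> s) \<in> subdists X \<and> eval (subst \<sigma> s) x \<le> eval (subst \<sigma> t) x" for x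
  proof -
    consider "(s, t) \<in> weight_ineqs" | "(s, t) \<in> projection_eqs" | "(t, s) \<in> projection_eqs"
      | "(s, t) \<in> composition_eqs" | "(t, s) \<in> composition_eqs"
      using st by (auto simp: subconvex_theory_def)
    then show ?thesis
    proof cases
      case 1
      then obtain ps qs where *: "s = comb ps" "t = comb qs" "subconvex ps" "list_all2 (\<le>) ps qs"
        unfolding weight_ineqs_def by auto
      have len: "length ps = length qs" using *(4) by (rule list_all2_lengthD)
      have "0 \<le> eval (\<sigma> i) x" if "i < length qs" for i
        using \<sigma> that * by (intro subdistsD(1)[OF eval_in_subdists]) (auto simp: set2_trm_comb)
      then have "eval (subst \<sigma> s) x \<le> eval (subst \<sigma> t) x"
        using * len by (auto simp: eval_subst_comb list_all2_conv_all_nth intro!: sum_mono mult_right_mono)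
      then show ?thesis using comb[OF *(3)] \<sigma> * by (simp add: set2_trm_comb)
    next
      case 2
      moreover have "eval (subst \<sigma> t) \<in> subdists X"
        using 2 \<sigma> unfolding projection_eqs_def by (auto intro: eval_in_subdists)
      ultimately show ?thesis using eval_subst_projection[of s t \<sigma>] by simp
    next
      case 3
      moreover have "eval (subst \<sigma> s) \<in> subdists X"
        using 3 \<sigma> unfolding projection_eqs_def by (auto intro: eval_in_subdists)
      ultimately show ?thesis using eval_subst_projection[of t s \<sigma>] by simp
    next
      case 4
      then show ?thesis
        using composition_in_subdists[of s t \<sigma> X] \<sigma> eval_subst_composition[of s t \<sigma>] by simp
    next
      case 5
      then show ?thesis
        using composition_in_subdists[of t s \<sigma> X] \<sigma> eval_subst_composition[of t s \<sigma>] by simp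
    qed
  qed
  then show "eval (subst \<sigma> s) \<in> subdists X" "\<And>x. eval (subst \<sigma> s) x \<le> eval (subst \<sigma> t) x"
    by auto
qed

text \<open>The induction is on \<open>coupling_le\<close> rather than \<open>subdist_order\<close>,
  so the intermediate terms of a derivation need not be shown to be well formed.\<close>

lemma coupling_le_eval_if_derivable:
  assumes "refl_on X r" "trans r" "derivable subconvex_theory X r s t"
  shows "coupling_le r (eval s) (eval t)"
  using assms(3)
proof (induction rule: derivable.induct)
  case (var x y)
  have "is_coupling r {x, y} (\<lambda>u v. if u = x \<and> v = y then 1 else 0) (eval (Var x)) (eval (Var y))"
    using var unfolding is_coupling_def by (auto simp: sum.delta)
  then show ?case unfolding coupling_le_def by blast
next
  case (mon ps ss ts)
  have ps: "subconvex ps" "length ss = length ps"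
    using mon by (auto simp: subconvex_theory_def)
  have len: "length ts = length ps"
    using mon.IH ps(2) by (auto dest: list_all2_lengthD)
  show ?case
    using mon.IH ps len subconvex_nth[OF ps(1)]
    by (auto simp: eval_Op list_all2_conv_all_nth intro!: coupling_le_sum)
next
  case (trans s t u)
  then show ?case using coupling_le_trans[OF assms(2)] by blast
next
  case (ax s t \<sigma>)
  then show ?case by (rule coupling_le_eval_subst_inequation[OF assms(1)])
qed

section \<open>Normal forms and completeness\<close>

abbreviation derivably_equal :: "'v set \<Rightarrow> 'v rel \<Rightarrow> (real list, 'v) trm \<Rightarrow> (real list, 'v) trm \<Rightarrow> bool" where
  "derivably_equal X r s t \<equiv> derivable subconvex_theory X r s t \<and> derivable subconvex_theory X r t s"

text \<open>The axiom is instantiated by \<open>(!) ts\<close>: its numbered variables become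
  positions in the argument list. The composition and weight axioms are used in the same way
  below.\<close>

lemma derivably_equal_projection:
  assumes "i < length ts" "set ts \<subseteq> terms subconvex_theory X"
  shows "derivably_equal X r (Op (map (\<lambda>k. if i = k then 1 else 0) [0..<length ts]) ts) (ts ! i)"
proof -
  let ?s = "comb (map (\<lambda>k. if i = k then 1 else 0) [0..<length ts])"
  have ax: "(?s, Var i) \<in> inequations subconvex_theory" "(Var i, ?s) \<in> inequations subconvex_theory"
    using assms(1) by (auto simp: subconvex_theory_def projection_eqs_def)
  have "\<forall>v\<in>set2_trm ?s \<union> set2_trm (Var i). ts ! v \<in> terms subconvex_theory X"
    using assms by (simp add: set2_trm_comb subset_code(1))
  with ax have "derivably_equal X r (subst ((!) ts) ?s) (subst ((!) ts) (Var i))"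
    by (intro conjI derivable.ax) auto
  then show ?thesis by (simp add: subst_comb map_nth)
qed

lemma derivably_equal_composition:
  assumes "subconvex ps" "length qss = length ps" "\<forall>qs\<in>set qss. subconvex qs \<and> length qs = length ts"
    and "set ts \<subseteq> terms subconvex_theory X"
  shows "derivably_equal X r (Op ps (map (\<lambda>qs. Op qs ts) qss))
    (Op (map (\<lambda>k. \<Sum>i<length ps. ps ! i * qss ! i ! k) [0..<length ts]) ts)"
proof -
  let ?s = "Op ps (map comb qss)"
  let ?t = "comb (map (\<lambda>k. \<Sum>i<length ps. ps ! i * qss ! i ! k) [0..<length ts])"
  have "(?s, ?t) \<in> composition_eqs"
    using assms(1-3) unfolding composition_eqs_def
    by (intro CollectI exI[of _ ps] exI[of _ qss] exI[of _ "length ts"]) auto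
  then have ax: "(?s, ?t) \<in> inequations subconvex_theory" "(?t, ?s) \<in> inequations subconvex_theory"
    unfolding subconvex_theory_def by simp_all
  have "\<forall>v\<in>set2_trm ?s \<union> set2_trm ?t. ts ! v \<in> terms subconvex_theory X"
    using assms(3,4) by (auto simp: set2_trm_comb subset_code(1))
  with ax have "derivably_equal X r (subst ((!) ts) ?s) (subst ((!) ts) ?t)"
    by (intro conjI derivable.ax) auto
  moreover have "subst ((!) ts) ?s = Op ps (map (\<lambda>qs. Op qs ts) qss)"
    using assms(3) by (auto simp: subst_comb map_nth simp del: upt_Suc)
  moreover have "subst ((!) ts) ?t = Op (map (\<lambda>k. \<Sum>i<length ps. ps ! i * qss ! i ! k) [0..<length ts]) ts"
    by (simp add: subst_comb map_nth)
  ultimately show ?thesis by argo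
qed

lemma derivable_weight:
  assumes "subconvex ps" "subconvex qs" "list_all2 (\<le>) ps qs" "length ts = length ps"
    and "set ts \<subseteq> terms subconvex_theory X"
  shows "derivable subconvex_theory X r (Op ps ts) (Op qs ts)"
proof -
  have len: "length qs = length ps" using list_all2_lengthD[OF assms(3)] by simp
  have "(comb ps, comb qs) \<in> inequations subconvex_theory"
    using assms(1-3) unfolding subconvex_theory_def weight_ineqs_def by auto
  moreover have "\<forall>v\<in>set2_trm (comb ps) \<union> set2_trm (comb qs). ts ! v \<in> terms subconvex_theory X"
    using assms(4,5) len by (simp add: set2_trm_comb subset_code(1))
  ultimately have "derivable subconvex_theory X r (subst ((!) ts) (comb ps)) (subst ((!) ts) (comb qs))"
    by (rule derivable.ax)
  then show ?thesis
    using assms(4) len map_nth[of ts] by (simp add: subst_comb)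
qed

text \<open>The list \<open>zs\<close> is a parameter, not the support of \<open>\<mu>\<close>, and
  zero weights are allowed: several terms can then be written over the same variables and compared
  weight by weight.\<close>

definition normal_form :: "('a \<Rightarrow> real) \<Rightarrow> 'a list \<Rightarrow> (real list, 'a) trm" where
  "normal_form \<mu> zs = Op (map \<mu> zs) (map Var zs)"

lemma subconvex_map_subdist:
  assumes "\<mu> \<in> subdists X" "distinct zs"
  shows "subconvex (map \<mu> zs)"
  using subdistsD(1)[OF assms(1)] subdistsD(4)[OF assms(1), of "set zs"] assms(2)
  by (intro subconvexI) (auto simp: sum.distinct_set_conv_list)

text \<open>A variable is a combination with Kronecker weights, by the projection axiom. For an
  operation, all arguments are first written over the same list \<open>zs\<close>, because the
  composition axiom flattens only combinations with common arguments.\<close>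

lemma derivably_equal_normal_form:
  fixes X :: "'a set"
  assumes "refl_on X r" "t \<in> terms subconvex_theory X"
    and zs: "distinct zs" "set2_trm t \<subseteq> set zs" "set zs \<subseteq> X"
  shows "derivably_equal X r t (normal_form (eval t) zs)"
  using assms(2) zs(2)
proof (induction t rule: terms.induct)
  case (Var x)
  have *: "set (map Var zs) \<subseteq> terms subconvex_theory X"
    using zs by (auto intro: terms.Var)
  obtain i where i: "i < length zs" "zs ! i = x"
    using Var by (auto simp: in_set_conv_nth)
  have "map (eval (Var x)) zs = map (\<lambda>k. if i = k then 1 else 0) [0..<length zs]"
    using i zs(1) by (intro nth_equalityI) (auto simp: nth_eq_iff_index_eq)
  then show ?case
    using derivably_equal_projection[OF _ *, of i r] i by (simp add: normal_form_def)
next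
  case (Op ps ts)
  have ps: "subconvex ps" "length ts = length ps"
    using Op.hyps by (auto simp: subconvex_theory_def)
  have ts: "\<And>t. t \<in> set ts \<Longrightarrow> eval t \<in> subdists X"
    using Op.IH eval_in_subdists by blast
  have IH: "derivably_equal X r t (normal_form (eval t) zs)" if "t \<in> set ts" for t
    using Op.IH Op.prems that by auto
  let ?nf = "map (\<lambda>t. normal_form (eval t) zs) ts"
  have "derivably_equal X r (Op ps ts) (Op ps ?nf)"
    using IH Op.hyps by (auto intro!: derivable.mon simp: list_all2_conv_all_nth)
  moreover have "derivably_equal X r (Op ps ?nf) (normal_form (eval (Op ps ts)) zs)"
  proof -
    let ?qss = "map (\<lambda>t. map (eval t) zs) ts"
    let ?vs = "map Var zs :: (real list, 'a) trm list"
    \<comment> \<open>For empty \<open>ps\<close> the inner arity of the composition axiom is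
      unconstrained; this instance turns the nullary operation into the combination of all of
      \<open>zs\<close> with zero weights.\<close>
    have "derivably_equal X r (Op ps (map (\<lambda>qs. Op qs ?vs) ?qss))
      (Op (map (\<lambda>k. \<Sum>i<length ps. ps ! i * ?qss ! i ! k) [0..<length ?vs]) ?vs)"
      by (rule derivably_equal_composition)
        (use ps ts zs in \<open>auto intro: subconvex_map_subdist terms.Var\<close>)
    moreover have "map (\<lambda>k. \<Sum>i<length ps. ps ! i * ?qss ! i ! k) [0..<length ?vs]
        = map (eval (Op ps ts)) zs"
      using ps(2) by (intro nth_equalityI) (auto simp: eval_Op)
    ultimately show ?thesis by (simp add: normal_form_def comp_def)
  qed
  ultimately show ?case by (blast intro: derivable.trans)
qed

text \<open>Over a list containing the variables of both terms, the two normal forms differ only in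
  their weights, so the weight axiom applies.\<close>

lemma derivable_if_eval_le:
  assumes "refl_on X r" and terms: "s \<in> terms subconvex_theory X" "t \<in> terms subconvex_theory X"
    and le: "\<And>x. eval s x \<le> eval t x"
  shows "derivable subconvex_theory X r s t"
proof -
  obtain zs where zs: "distinct zs" "set zs = set2_trm s \<union> set2_trm t"
    using finite_distinct_list[of "set2_trm s \<union> set2_trm t"] finite_set2_trm by blast
  have sub: "set zs \<subseteq> X" using set2_trm_subset terms zs(2) by blast
  have "derivable subconvex_theory X r s (normal_form (eval s) zs)"
    using derivably_equal_normal_form[OF assms(1) terms(1) zs(1) _ sub] zs(2) by blast
  moreover have "derivable subconvex_theory X r (normal_form (eval s) zs) (normal_form (eval t) zs)"
    unfolding normal_form_def using zs(1) sub le terms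
    by (intro derivable_weight subconvex_map_subdist eval_in_subdists)
      (auto simp: list_all2_conv_all_nth intro: terms.Var)
  moreover have "derivable subconvex_theory X r (normal_form (eval t) zs) t"
    using derivably_equal_normal_form[OF assms(1) terms(2) zs(1) _ sub] zs(2) by blast
  ultimately show ?thesis by (blast intro: derivable.trans)
qed

text \<open>The derivation passes through terms \<open>A\<close> and \<open>B\<close>. Exact row
  sums give \<open>A\<close> the value of \<open>s\<close>, monotonicity derives \<open>A\<close>
  below \<open>B\<close>, and the column bounds place the value of \<open>B\<close> pointwise below
  that of \<open>t\<close>.\<close>

lemma derivable_if_coupling_le_eval:
  assumes "refl_on X r" and terms: "s \<in> terms subconvex_theory X" "t \<in> terms subconvex_theory X"
    and r: "r \<subseteq> X \<times> X" and le: "coupling_le r (eval s) (eval t)"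
  shows "derivable subconvex_theory X r s t"
proof -
  obtain F \<gamma> where cpl: "is_coupling r F \<gamma> (eval s) (eval t)"
    using le unfolding coupling_le_def by blast
  then have fin: "finite F" and \<gamma>0: "\<And>x y. 0 \<le> \<gamma> x y"
    and row: "\<And>x. eval s x = (\<Sum>y\<in>F. \<gamma> x y)" and col: "\<And>y. (\<Sum>x\<in>F. \<gamma> x y) \<le> eval t y"
    unfolding is_coupling_def by auto
  have supp: "(x, y) \<in> F \<times> F \<inter> r" if "\<gamma> x y \<noteq> 0" for x y
    using cpl that unfolding is_coupling_def by blast
  have "finite {l \<in> F \<times> F. case_prod \<gamma> l \<noteq> 0}" using fin by simp
  \<comment> \<open>Only cells with nonzero mass are listed, since cells without mass may lie
    outside \<open>r\<close>.\<close>
  then obtain L where L: "distinct L" "set L = {l \<in> F \<times> F. case_prod \<gamma> l \<noteq> 0}"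
    using finite_distinct_list by blast
  have Lr: "l \<in> r" if "l \<in> set L" for l using that L(2) supp by auto
  define ws where "ws = map (case_prod \<gamma>) L"
  have sum_L: "(\<Sum>l\<in>set L. g l) = (\<Sum>x\<in>F. \<Sum>y\<in>F. g (x, y))"
    if "\<And>x y. \<gamma> x y = 0 \<Longrightarrow> g (x, y) = 0" for g :: "'a \<times> 'a \<Rightarrow> real"
  proof -
    have "(\<Sum>l\<in>set L. g l) = (\<Sum>l\<in>F \<times> F. g l)"
      using that fin L(2) by (intro sum.mono_neutral_left) auto
    then show ?thesis by (simp add: sum.cartesian_product)
  qed
  have "sum_list ws = (\<Sum>l\<in>set L. case_prod \<gamma> l)"
    unfolding ws_def using L(1) by (simp add: sum.distinct_set_conv_list)
  also have "\<dots> = (\<Sum>x\<in>F. eval s x)" by (subst sum_L) (auto simp: row)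
  also have "\<dots> \<le> 1" by (rule subdistsD(4)[OF eval_in_subdists[OF terms(1)] fin])
  finally have ws: "subconvex ws"
    using \<gamma>0 by (intro subconvexI) (auto simp: ws_def)
  \<comment> \<open>The two terms have the same weights, one per cell of the coupling, and are thus
    instances of one operation; only their variables differ, argument by argument along
    \<open>r\<close>.\<close>
  define A B where "A = Op ws (map Var (map fst L))" and "B = Op ws (map Var (map snd L))"
  have A: "A \<in> terms subconvex_theory X" and B: "B \<in> terms subconvex_theory X"
    unfolding A_def B_def Op_in_terms_iff
    using ws Lr r by (auto simp: ws_def intro!: terms.Var dest!: Lr)
  \<comment> \<open>Taking \<open>fst\<close> and \<open>snd\<close> for \<open>h\<close> yields the
    two marginals of the coupling.\<close>
  have marginal: "eval (Op ws (map Var (map h L))) z = (\<Sum>x\<in>F. \<Sum>y\<in>F. if h (x, y) = z then \<gamma> x y else 0)"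
    for h z
  proof -
    have "eval (Op ws (map Var (map h L))) z = subdist_of (map (\<lambda>l. (case_prod \<gamma> l, h l)) L) z"
      by (subst eval_Op_Var) (simp_all add: ws_def zip_map_map zip_same_conv_map comp_def)
    also have "\<dots> = (\<Sum>x\<in>F. \<Sum>y\<in>F. if h (x, y) = z then \<gamma> x y else 0)"
      by (subst subdist_of_map[OF L(1)], subst sum_L) auto
    finally show ?thesis .
  qed
  have evalA: "eval A x = eval s x" for x
  proof -
    have "eval A x = (\<Sum>u\<in>F. if u = x then (\<Sum>y\<in>F. \<gamma> u y) else 0)"
      unfolding A_def marginal by (intro sum.cong) auto
    also have "\<dots> = (if x \<in> F then \<Sum>y\<in>F. \<gamma> x y else 0)" using fin by (simp add: sum.delta)
    also have "\<dots> = eval s x" using supp by (auto simp: row intro!: sum.neutral)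
    finally show ?thesis .
  qed
  have evalB: "eval B y \<le> eval t y" for y
  proof -
    have "eval B y = (\<Sum>v\<in>F. if v = y then (\<Sum>x\<in>F. \<gamma> x v) else 0)"
      unfolding B_def marginal by (subst sum.swap) (auto intro!: sum.cong)
    also have "\<dots> = (if y \<in> F then \<Sum>x\<in>F. \<gamma> x y else 0)" using fin by (simp add: sum.delta)
    also have "\<dots> \<le> eval t y"
      using col subdistsD(1)[OF eval_in_subdists[OF terms(2)]] by simp
    finally show ?thesis .
  qed
  have "derivable subconvex_theory X r s A"
    using evalA by (intro derivable_if_eval_le assms A) auto
  moreover have "derivable subconvex_theory X r A B"
    unfolding A_def B_def
  proof (rule derivable.mon)
    show "ws \<in> operations subconvex_theory" using ws by (simp add: subconvex_theory_def)
    show "length (map Var (map fst L)) = arity subconvex_theory ws"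
      by (simp add: subconvex_theory_def ws_def)
    have "derivable subconvex_theory X r (Var (fst l)) (Var (snd l))" if "l \<in> set L" for l
      using Lr[OF that] r by (intro derivable.var) auto
    then show "list_all2 (derivable subconvex_theory X r) (map Var (map fst L)) (map Var (map snd L))"
      by (simp add: list_all2_conv_all_nth)
  qed
  moreover have "derivable subconvex_theory X r B t"
    using evalB by (intro derivable_if_eval_le assms B) auto
  ultimately show ?thesis by (blast intro: derivable.trans)
qed


section \<open>The free model\<close>

lemma derivable_iff_subdist_order:
  assumes "partial_order_on X r" "s \<in> terms subconvex_theory X" "t \<in> terms subconvex_theory X"
  shows "derivable subconvex_theory X r s t \<longleftrightarrow> (eval s, eval t) \<in> subdist_order X r"
proof -
  have "refl_on X r" "trans r" "r \<subseteq> X \<times> X"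
    using assms(1) by (auto simp: order_on_defs)
  then show ?thesis
    using coupling_le_eval_if_derivable derivable_if_coupling_le_eval eval_in_subdists assms(2,3)
    unfolding subdist_order_iff by blast
qed

text \<open>Antisymmetry of the order on subdistributions turns two derivable inequations into equal
  values, and its reflexivity gives the converse.\<close>

lemma derivable_eq_iff_eval_eq:
  assumes "partial_order_on X r" "s \<in> terms subconvex_theory X" "t \<in> terms subconvex_theory X"
  shows "(s, t) \<in> derivable_eq subconvex_theory X r \<longleftrightarrow> eval s = eval t"
proof -
  have "eval s = eval t \<longleftrightarrow>
      (eval s, eval t) \<in> subdist_order X r \<and> (eval t, eval s) \<in> subdist_order X r"
    using partial_order_on_subdist_order[OF assms(1)] assms(2,3)
    by (auto simp: order_on_defs refl_on_def dest: antisymD intro: eval_in_subdists)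
  then show ?thesis
    using assms by (simp add: derivable_eq_def derivable_iff_subdist_order)
qed

text \<open>The isomorphism of the theorem. On classes of terms the choice of representative does
  not matter, by \<open>class_eval_term_class\<close>.\<close>

definition class_eval :: "(real list, 'a) trm set \<Rightarrow> 'a \<Rightarrow> real" where
  "class_eval A = eval (SOME t. t \<in> A)"

lemma class_eval_term_class:
  assumes "partial_order_on X r" "t \<in> terms subconvex_theory X"
  shows "class_eval (term_class subconvex_theory X r t) = eval t"
proof -
  have "t \<in> term_class subconvex_theory X r t"
    using derivable_eq_iff_eval_eq[OF assms assms(2)] by (simp add: term_class_def)
  then have "(SOME s. s \<in> term_class subconvex_theory X r t) \<in> term_class subconvex_theory X r t"
    by (rule someI)
  then have *: "(t, SOME s. s \<in> term_class subconvex_theory X r t) \<in> derivable_eq subconvex_theory X r"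
    by (simp add: term_class_def)
  then have "(SOME s. s \<in> term_class subconvex_theory X r t) \<in> terms subconvex_theory X"
    unfolding derivable_eq_def by blast
  with * show ?thesis
    using derivable_eq_iff_eval_eq[OF assms] by (simp add: class_eval_def)
qed

lemma free_model_alt: "free_model T X r = term_class T X r ` terms T X"
  by (auto simp: free_model_def quotient_def term_class_def)

lemma term_class_eq_iff:
  assumes "partial_order_on X r" "s \<in> terms subconvex_theory X" "t \<in> terms subconvex_theory X"
  shows "term_class subconvex_theory X r s = term_class subconvex_theory X r t \<longleftrightarrow> eval s = eval t"
proof
  assume "term_class subconvex_theory X r s = term_class subconvex_theory X r t"
  then show "eval s = eval t"
    using class_eval_term_class[OF assms(1)] assms(2,3) by metis
next
  assume *: "eval s = eval t"
  have "(s, u) \<in> derivable_eq subconvex_theory X r \<longleftrightarrow> (t, u) \<in> derivable_eq subconvex_theory X r" for u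
  proof (cases "u \<in> terms subconvex_theory X")
    case True
    then show ?thesis using assms * by (simp add: derivable_eq_iff_eval_eq)
  qed (simp add: derivable_eq_def)
  then show "term_class subconvex_theory X r s = term_class subconvex_theory X r t"
    unfolding term_class_def by blast
qed

text \<open>Surjectivity: the normal form over the support of a subdistribution evaluates to
  it.\<close>

lemma eval_image_terms: "eval ` terms subconvex_theory X = subdists X"
proof (intro subset_antisym subsetI)
  fix \<mu> assume \<mu>: "\<mu> \<in> subdists X"
  then obtain zs where zs: "distinct zs" "set zs = {x. \<mu> x \<noteq> 0}"
    using finite_distinct_list[OF subdistsD(3)[OF \<mu>]] by blast
  have nf: "normal_form \<mu> zs \<in> terms subconvex_theory X"
    using subconvex_map_subdist[OF \<mu> zs(1)] zs(2) subdistsD(2)[OF \<mu>]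
    by (auto simp: normal_form_def Op_in_terms_iff intro!: terms.Var)
  have "eval (normal_form \<mu> zs) = \<mu>"
  proof
    fix x
    have "eval (normal_form \<mu> zs) x = subdist_of (map (\<lambda>z. (\<mu> z, z)) zs) x"
      unfolding normal_form_def by (subst eval_Op_Var) (simp_all add: zip_map1 zip_same_conv_map comp_def)
    also have "\<dots> = \<mu> x"
      using zs subdistsD(3)[OF \<mu>] by (simp add: subdist_of_map sum.delta)
    finally show "eval (normal_form \<mu> zs) x = \<mu> x" .
  qed
  then show "\<mu> \<in> eval ` terms subconvex_theory X" using nf by (rule image_eqI[OF sym])
qed (auto intro: eval_in_subdists)

text \<open>\<open>free_order\<close> only provides some representatives of the two classes; equal
  classes have equal values, so the comparison carries over to \<open>s\<close> and
  \<open>t\<close>.\<close>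

lemma free_order_iff:
  assumes "partial_order_on X r" "s \<in> terms subconvex_theory X" "t \<in> terms subconvex_theory X"
  shows "(term_class subconvex_theory X r s, term_class subconvex_theory X r t) \<in> free_order subconvex_theory X r
    \<longleftrightarrow> (eval s, eval t) \<in> subdist_order X r"
proof
  assume "(term_class subconvex_theory X r s, term_class subconvex_theory X r t) \<in> free_order subconvex_theory X r"
  then obtain s' t' where *: "s' \<in> terms subconvex_theory X" "t' \<in> terms subconvex_theory X"
    "derivable subconvex_theory X r s' t'"
    "term_class subconvex_theory X r s = term_class subconvex_theory X r s'"
    "term_class subconvex_theory X r t = term_class subconvex_theory X r t'"
    unfolding free_order_def by blast
  then show "(eval s, eval t) \<in> subdist_order X r"
    using assms by (simp add: term_class_eq_iff derivable_iff_subdist_order)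
next
  assume "(eval s, eval t) \<in> subdist_order X r"
  then show "(term_class subconvex_theory X r s, term_class subconvex_theory X r t) \<in> free_order subconvex_theory X r"
    unfolding free_order_def using assms derivable_iff_subdist_order[OF assms] by auto
qed

text \<open>The clauses on variables and operations make \<open>\<theta>\<close> the canonical
  comparison, respecting the unit and the algebra structure, rather than an arbitrary order
  isomorphism.\<close>

theorem mainTheorem11:
  fixes X :: "'a set" and r :: "'a rel"
  assumes "partial_order_on X r"
  shows "partial_order_on (subdists X) (subdist_order X r) \<and>
    subdist_of ` formal_sums X = subdists X \<and>
    (\<forall>c\<in>formal_sums X. \<forall>d\<in>formal_sums X.
      (subdist_of c, subdist_of d) \<in> subdist_order X r \<longleftrightarrow> formal_le r c d) \<and>
    (\<exists>\<theta>. bij_betw \<theta> (free_model subconvex_theory X r) (subdists X) \<and>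
      (\<forall>A\<in>free_model subconvex_theory X r. \<forall>B\<in>free_model subconvex_theory X r.
        (A, B) \<in> free_order subconvex_theory X r \<longleftrightarrow> (\<theta> A, \<theta> B) \<in> subdist_order X r) \<and>
      (\<forall>x\<in>X. \<theta> (term_class subconvex_theory X r (Var x)) = (\<lambda>y. if y = x then 1 else 0)) \<and>
      (\<forall>ps ts. subconvex ps \<and> length ts = length ps \<and> set ts \<subseteq> terms subconvex_theory X \<longrightarrow>
        \<theta> (term_class subconvex_theory X r (Op ps ts)) =
          (\<lambda>y. \<Sum>i<length ps. ps ! i * \<theta> (term_class subconvex_theory X r (ts ! i)) y)))"
proof (intro conjI exI[of _ class_eval] ballI allI impI)
  note class_eval = class_eval_term_class[OF assms]
  show "partial_order_on (subdists X) (subdist_order X r)"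
    by (rule partial_order_on_subdist_order[OF assms])
  show "subdist_of ` formal_sums X = subdists X"
    by (rule subdist_of_image)
  show "(subdist_of c, subdist_of d) \<in> subdist_order X r \<longleftrightarrow> formal_le r c d"
    if "c \<in> formal_sums X" "d \<in> formal_sums X" for c d
    using that subdist_of_image[of X] by (auto simp: subdist_order_iff formal_le_iff_coupling_le)
  show "bij_betw class_eval (free_model subconvex_theory X r) (subdists X)"
    unfolding bij_betw_def free_model_alt
    using term_class_eq_iff[OF assms]
    by (auto simp: inj_on_def class_eval image_image eval_image_terms cong: image_cong_simp)
  show "(A, B) \<in> free_order subconvex_theory X r \<longleftrightarrow> (class_eval A, class_eval B) \<in> subdist_order X r"
    if "A \<in> free_model subconvex_theory X r" "B \<in> free_model subconvex_theory X r" for A B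
    using that free_order_iff[OF assms] by (auto simp: free_model_alt class_eval)
  show "class_eval (term_class subconvex_theory X r (Var x)) = (\<lambda>y. if y = x then 1 else 0)"
    if "x \<in> X" for x
    using that by (simp add: class_eval terms.Var)
  show "class_eval (term_class subconvex_theory X r (Op ps ts)) =
      (\<lambda>y. \<Sum>i<length ps. ps ! i * class_eval (term_class subconvex_theory X r (ts ! i)) y)"
    if "subconvex ps \<and> length ts = length ps \<and> set ts \<subseteq> terms subconvex_theory X" for ps ts
    using that by (simp add: class_eval Op_in_terms_iff eval_Op subset_code(1))
qed

end
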